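(* Let $S$ be an Arf numerical semigroup with multiplicity $2$ and a positive even conductor $s$. Then $S=\langle 2,s+1\rangle$, $\mathrm{PF}(S)=\{s-1\}$, and the unique row-factorization matrix of $s-1$ is \[\begin{bmatrix}-1&1\\ s&-1\end{bmatrix}.\]
   Context: A numerical semigroup is a subset $S\subseteq\mathbb{N}_0$ (non-negative integers) containing $0$, closed under addition, with finite complement in $\mathbb{N}_0$; $\langle A\rangle$ is the set of $\mathbb{N}_0$-linear combinations of elements of $A$. The multiplicity is the smallest nonzero element of $S$; the conductor is one plus the greatest integer not in $S$. $S$ is Arf if $s_2+s_3-s_1\in S$ for all $s_1\le s_2\le s_3$ in $S$. $\mathrm{PF}(S)$ is the set of integers $z\notin S$ with $z+x\in S$ for all nonzero $x\in S$. If $n_1<\dots<n_e$ are the minimal generators of $S$, a row-factorization matrix of $f\in\mathrm{PF}(S)$ is an $e\times e$ integer matrix $[a_{ij}]$ with $a_{ii}=-1$, $a_{ij}\in\mathbb{N}_0$ for $i\ne j$, and $f=\sum_{j=1}^e a_{ij}n_j$ for each $i$. *)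

theory Defs
  imports "Jordan_Normal_Form.Matrix"
begin

definition numerical_semigroup :: "nat set \<Rightarrow> bool" where
  "numerical_semigroup S \<longleftrightarrow>
     0 \<in> S \<and> (\<forall>x\<in>S. \<forall>y\<in>S. x + y \<in> S) \<and> finite (- S)"

definition generated :: "nat set \<Rightarrow> nat set" where
  "generated A = {\<Sum>a\<in>F. c a * a | F (c :: nat \<Rightarrow> nat). finite F \<and> F \<subseteq> A}"

definition multiplicity_of :: "nat set \<Rightarrow> nat" where
  "multiplicity_of S = (LEAST x. x \<in> S \<and> x \<noteq> 0)"

(* The greatest element is taken over the integers, so that the conductor of the
   full semigroup of non-negative integers is 0. *)
definition conductor :: "nat set \<Rightarrow> int" where
  "conductor S = 1 + (GREATEST z. z \<notin> int ` S)"

(* The subtraction on nat does not truncate, because s1 \<le> s2. *)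
definition Arf :: "nat set \<Rightarrow> bool" where
  "Arf S \<longleftrightarrow>
     (\<forall>s1\<in>S. \<forall>s2\<in>S. \<forall>s3\<in>S. s1 \<le> s2 \<longrightarrow> s2 \<le> s3 \<longrightarrow> s2 + s3 - s1 \<in> S)"

definition PF :: "nat set \<Rightarrow> int set" where
  "PF S = {z. z \<notin> int ` S \<and> (\<forall>x\<in>S. x \<noteq> 0 \<longrightarrow> z + int x \<in> int ` S)}"

definition minimal_generating_set :: "nat set \<Rightarrow> nat set \<Rightarrow> bool" where
  "minimal_generating_set S A \<longleftrightarrow> generated A = S \<and> (\<forall>B. B \<subset> A \<longrightarrow> generated B \<noteq> S)"

(* Well defined by the lemma ex1_minimal_generating_set below. *)
definition minimal_generators :: "nat set \<Rightarrow> nat set" where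
  "minimal_generators S = (THE A. minimal_generating_set S A)"

(* Rows and columns are indexed from 0, so the entry at (i, j) is the coefficient of
   the (j+1)-st smallest minimal generator in the (i+1)-st row. *)
definition row_factorization_matrix :: "nat set \<Rightarrow> int \<Rightarrow> int mat \<Rightarrow> bool" where
  "row_factorization_matrix S f M \<longleftrightarrow>
     (let ns = sorted_list_of_set (minimal_generators S); e = length ns in
        f \<in> PF S \<and> M \<in> carrier_mat e e \<and>
        (\<forall>i<e. M $$ (i, i) = -1) \<and>
        (\<forall>i<e. \<forall>j<e. i \<noteq> j \<longrightarrow> 0 \<le> M $$ (i, j)) \<and>
        (\<forall>i<e. f = (\<Sum>j<e. M $$ (i, j) * int (ns ! j))))"

lemma generated_add:
  assumes "x \<in> generated A" "y \<in> generated A"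
  shows "x + y \<in> generated A"
proof -
  obtain F c where F: "finite F" "F \<subseteq> A" "x = (\<Sum>a\<in>F. c a * a)"
    using assms(1) unfolding generated_def by blast
  obtain G d where G: "finite G" "G \<subseteq> A" "y = (\<Sum>a\<in>G. d a * a)"
    using assms(2) unfolding generated_def by blast
  define h where "h = (\<lambda>a. (if a \<in> F then c a else 0) + (if a \<in> G then d a else 0))"
  have "x = (\<Sum>a\<in>F \<union> G. (if a \<in> F then c a else 0) * a)"
    unfolding F(3) using F(1) G(1) by (intro sum.mono_neutral_cong_left) auto
  moreover have "y = (\<Sum>a\<in>F \<union> G. (if a \<in> G then d a else 0) * a)"
    unfolding G(3) using F(1) G(1) by (intro sum.mono_neutral_cong_left) auto
  ultimately have "x + y = (\<Sum>a\<in>F \<union> G. h a * a)"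
    by (simp add: h_def sum.distrib add_mult_distrib)
  then show ?thesis
    unfolding generated_def using F(1,2) G(1,2) by blast
qed

lemma generated_base: "a \<in> A \<Longrightarrow> a \<in> generated A"
  unfolding generated_def
  by (rule CollectI, rule exI[of _ "{a}"], rule exI[of _ "\<lambda>_. 1"]) simp

lemma generated_zero: "0 \<in> generated A"
  unfolding generated_def by (rule CollectI, rule exI[of _ "{}"]) simp

lemma ex1_minimal_generating_set:
  assumes "numerical_semigroup S"
  shows "\<exists>!A. minimal_generating_set S A"
proof -
  have S: "0 \<in> S" "\<And>x y. x \<in> S \<Longrightarrow> y \<in> S \<Longrightarrow> x + y \<in> S"
    using assms by (auto simp: numerical_semigroup_def)
  define I where
    "I = {x \<in> S. x \<noteq> 0 \<and> \<not> (\<exists>a\<in>S. \<exists>b\<in>S. a \<noteq> 0 \<and> b \<noteq> 0 \<and> x = a + b)}"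
  have sub: "I \<subseteq> A" if A: "generated A = S" for A
  proof
    fix x assume x: "x \<in> I"
    then have "x \<in> generated A" using A by (auto simp: I_def)
    then obtain F c where F: "finite F" "F \<subseteq> A" "x = (\<Sum>a\<in>F. c a * a)"
      unfolding generated_def by blast
    have "(\<Sum>a\<in>F. c a * a) \<noteq> 0" using x F(3) by (simp add: I_def)
    then obtain a where a: "a \<in> F" "c a * a \<noteq> 0"
      by (rule sum.not_neutral_contains_not_neutral)
    then have ca: "c a * a = a + (c a - 1) * a" by (cases "c a") auto
    define r where "r = (\<Sum>b\<in>F. (c(a := c a - 1)) b * b)"
    have "r = (c a - 1) * a + (\<Sum>b\<in>F - {a}. c b * b)"
      unfolding r_def by (subst sum.remove[OF F(1) a(1)]) (auto intro!: sum.cong)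
    moreover have "x = c a * a + (\<Sum>b\<in>F - {a}. c b * b)"
      unfolding F(3) by (rule sum.remove[OF F(1) a(1)])
    ultimately have xr: "x = a + r" using ca by simp
    have "r \<in> S" unfolding A[symmetric] generated_def r_def using F(1,2) by blast
    moreover have "a \<in> S" using generated_base[of a A] A a(1) F(2) by blast
    moreover have "a \<noteq> 0" using a(2) by auto
    ultimately have "r = 0" using x xr by (auto simp: I_def)
    then show "x \<in> A" using xr a(1) F(2) by auto
  qed
  have SI: "x \<in> S \<Longrightarrow> x \<in> generated I" for x
  proof (induction x rule: less_induct)
    case (less x)
    show ?case
    proof (cases "x = 0 \<or> x \<in> I")
      case True
      then show ?thesis using generated_zero generated_base by auto
    next
      case False
      then obtain a b where ab: "a \<in> S" "b \<in> S" "a \<noteq> 0" "b \<noteq> 0" "x = a + b"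
        using less.prems by (auto simp: I_def)
      then have "a \<in> generated I" "b \<in> generated I" using less.IH by auto
      then show ?thesis using generated_add ab(5) by simp
    qed
  qed
  have IS: "generated I \<subseteq> S"
  proof
    fix x assume "x \<in> generated I"
    then obtain F c where F: "finite F" "F \<subseteq> I" "x = (\<Sum>a\<in>F. c a * a)"
      unfolding generated_def by blast
    have m: "k * a \<in> S" if "a \<in> S" for k a
      using that S by (induction k) auto
    have "F \<subseteq> S" using F(2) by (auto simp: I_def)
    with F(1) have "(\<Sum>a\<in>F. c a * a) \<in> S"
      by (induction F rule: finite_induct) (auto intro: S m)
    then show "x \<in> S" using F(3) by simp
  qed
  have gI: "generated I = S" using SI IS by blast
  show ?thesis
  proof (rule ex1I[of _ I])
    show "minimal_generating_set S I"
      unfolding minimal_generating_set_def using gI sub by blast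
    show "A = I" if "minimal_generating_set S A" for A
      using that gI sub unfolding minimal_generating_set_def by blast
  qed
qed

end

theory Submission
  imports Defs
begin

text \<open>
  Since \<open>2 \<in> S\<close>, all even numbers lie in \<open>S\<close>, and an odd number in \<open>S\<close> drags all larger odd
  numbers into \<open>S\<close>. The odd members therefore form a final segment of the odd numbers, and the
  conductor says where it starts: \<open>s - 1\<close> is the last gap. Hence \<open>S\<close> consists of the even
  numbers and all numbers from \<open>s\<close> on (\<open>multiplicity_two_mem_iff\<close>), and each claim can be
  read off this description:

  \<^item> The odd numbers from \<open>s + 1\<close> on are \<open>s + 1\<close> plus an even number, so \<open>2\<close> and \<open>s + 1\<close>
    generate \<open>S\<close>. Neither can be dropped: \<open>2\<close> alone gives no odd number, and \<open>s + 1 > 2\<close> alone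
    does not give \<open>2\<close>.

  \<^item> A gap \<open>z\<close> other than \<open>s - 1\<close> either is odd and below \<open>s - 1\<close>, so that \<open>z + 2\<close> is still a
    gap, or is even and negative, so that \<open>z + (s + 1)\<close> is odd and below \<open>s\<close>.

  \<^item> With the diagonal fixed at \<open>-1\<close>, each row of a row-factorization matrix has a single unknown,
    determined by one linear equation: \<open>s - 1 = -2 + a (s + 1)\<close> forces \<open>a = 1\<close>, and
    \<open>s - 1 = 2 b - (s + 1)\<close> forces \<open>b = s\<close>.
\<close>

lemma generated_least:
  assumes "A \<subseteq> T" "0 \<in> T" and add: "\<And>x y. x \<in> T \<Longrightarrow> y \<in> T \<Longrightarrow> x + y \<in> T"
  shows "generated A \<subseteq> T"
proof
  fix x assume "x \<in> generated A"
  then obtain F c where F: "finite F" "F \<subseteq> A" "x = (\<Sum>a\<in>F. c a * a)"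
    unfolding generated_def by blast
  have mult: "k * a \<in> T" if "a \<in> T" for k a
    using that assms(2) add by (induction k) auto
  have "F \<subseteq> T" using F(2) assms(1) by blast
  with F(1) have "(\<Sum>a\<in>F. c a * a) \<in> T"
    by (induction F rule: finite_induct) (auto intro: assms(2) add mult)
  then show "x \<in> T" using F(3) by simp
qed

lemma multiplicity_of_mem:
  assumes "numerical_semigroup S"
  shows "multiplicity_of S \<in> S"
proof -
  have "infinite S"
    using assms Compl_eq_Diff_UNIV finite_Diff2 infinite_UNIV_nat
    by (metis numerical_semigroup_def)
  then have "\<exists>x. x \<in> S \<and> x \<noteq> 0"
    by (metis finite.emptyI finite.insertI finite_subset insertI1 subsetI)
  then show ?thesis
    unfolding multiplicity_of_def by (rule LeastI2_ex) simp
qed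

text \<open>
  The greatest gap exists because the gaps are the negative integers together with the finitely
  many natural numbers outside \<open>S\<close>.
\<close>
lemma conductor_greatest_gap:
  assumes "numerical_semigroup S"
  shows "conductor S - 1 \<notin> int ` S" and "z \<notin> int ` S \<Longrightarrow> z \<le> conductor S - 1"
proof -
  \<comment> \<open>The element \<open>-1\<close> stands for all negative gaps and is the greatest gap when \<open>S\<close> is everything.\<close>
  define G where "G = insert (-1) (int ` (- S))"
  have G: "finite G" "G \<noteq> {}"
    using assms by (auto simp: G_def numerical_semigroup_def)
  have gap: "Max G \<notin> int ` S"
    using Max_in[OF G] by (auto simp: G_def)
  have upper: "z \<le> Max G" if "z \<notin> int ` S" for z
  proof (cases "z < 0")
    case True
    have "-1 \<le> Max G" using G(1) by (intro Max_ge) (auto simp: G_def)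
    with True show ?thesis by linarith
  next
    case False
    then have "z = int (nat z)" by simp
    with that have "z \<in> G" unfolding G_def by blast
    then show ?thesis using G(1) by (intro Max_ge)
  qed
  have "conductor S = 1 + Max G"
    unfolding conductor_def using gap upper by (simp add: Greatest_equality)
  then show "conductor S - 1 \<notin> int ` S" "z \<notin> int ` S \<Longrightarrow> z \<le> conductor S - 1"
    using gap upper by auto
qed

text \<open>
  An odd member below \<open>s\<close> would reach the gap \<open>s - 1\<close> by adding twos.
\<close>
lemma multiplicity_two_mem_iff:
  assumes S: "numerical_semigroup S" and mult: "multiplicity_of S = 2"
    and cond: "conductor S = int s" and s: "0 < s" "even s"
  shows "x \<in> S \<longleftrightarrow> even x \<or> s \<le> x"
proof -
  have zero: "0 \<in> S" and add: "\<And>x y. x \<in> S \<Longrightarrow> y \<in> S \<Longrightarrow> x + y \<in> S"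
    using S by (auto simp: numerical_semigroup_def)
  have two: "2 \<in> S" using multiplicity_of_mem[OF S] mult by simp
  have step: "y + 2 * k \<in> S" if "y \<in> S" for y k
  proof (induction k)
    case 0
    show ?case using that by simp
  next
    case (Suc k)
    then show ?case using add[OF _ two] by (simp add: add.assoc)
  qed
  have gap: "s - 1 \<notin> S"
    using conductor_greatest_gap(1)[OF S] cond s(1) by (auto simp: image_iff of_nat_diff)
  have large: "x \<in> S" if "s \<le> x"
    using conductor_greatest_gap(2)[OF S, of "int x"] cond that by force
  have evens: "x \<in> S" if "even x"
    using step[OF zero, of "x div 2"] that by simp
  have "x \<notin> S" if "odd x" "x < s"
  proof
    assume "x \<in> S"
    have "even (s - 1 - x)" "x \<le> s - 1" using that s by auto
    then have "x + 2 * ((s - 1 - x) div 2) = s - 1" by simp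
    with step[OF \<open>x \<in> S\<close>] gap show False by metis
  qed
  then show ?thesis using large evens by force
qed

lemma generated_two_odd:
  assumes "even s"
  shows "generated {2, s + 1} = {x. even x \<or> s \<le> x}"
proof
  show "generated {2, s + 1} \<subseteq> {x. even x \<or> s \<le> x}"
    by (rule generated_least) auto
next
  have evens: "2 * k \<in> generated {2, s + 1}" for k
  proof (induction k)
    case 0
    show ?case by (simp add: generated_zero)
  next
    case (Suc k)
    then show ?case
      using generated_add[OF generated_base[of 2 "{2, s + 1}"]] by fastforce
  qed
  show "{x. even x \<or> s \<le> x} \<subseteq> generated {2, s + 1}"
  proof
    fix x assume x: "x \<in> {x. even x \<or> s \<le> x}"
    show "x \<in> generated {2, s + 1}"
    proof (cases "even x")
      case True
      then show ?thesis using evens[of "x div 2"] by simp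
    next
      case False
      \<comment> \<open>As \<open>s\<close> is even, the odd \<open>x \<ge> s\<close> is at least \<open>s + 1\<close>, at even distance.\<close>
      then have "x \<noteq> s" "s \<le> x" using x assms by auto
      then have "s + 1 \<le> x" by simp
      moreover have "even (x - (s + 1))" using False assms \<open>s + 1 \<le> x\<close> by simp
      ultimately have "x = (s + 1) + 2 * ((x - (s + 1)) div 2)" by simp
      then show ?thesis
        using generated_add[OF generated_base[of "s + 1" "{2, s + 1}"] evens] by (metis insertCI)
    qed
  qed
qed

lemma minimal_generators_two_odd:
  assumes S: "numerical_semigroup S" "S = generated {2, s + 1}" and s: "0 < s" "even s"
  shows "minimal_generators S = {2, s + 1}"
proof -
  have "generated B \<noteq> S" if B: "B \<subset> {2, s + 1}" for B
  proof -
    consider "B \<subseteq> {2}" | "B \<subseteq> {s + 1}" using B by blast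
    then show ?thesis
    proof cases
      case 1
      then have "generated B \<subseteq> {x. even x}" by (intro generated_least) auto
      moreover have "s + 1 \<in> S" unfolding S(2) by (simp add: generated_base)
      ultimately show ?thesis using s by auto
    next
      case 2
      then have "generated B \<subseteq> {x. x = 0 \<or> s + 1 \<le> x}" by (intro generated_least) auto
      moreover have "2 \<in> S" unfolding S(2) by (simp add: generated_base)
      moreover have "2 < s + 1" using s by presburger
      ultimately show ?thesis by auto
    qed
  qed
  then have "minimal_generating_set S {2, s + 1}"
    unfolding minimal_generating_set_def using S(2) by blast
  then show ?thesis
    unfolding minimal_generators_def
    using ex1_minimal_generating_set[OF S(1)] by (rule the1_equality[rotated])
qed

lemma PF_two_odd:
  assumes mem: "\<And>x. x \<in> S \<longleftrightarrow> even x \<or> s \<le> x" and s: "0 < s" "even s"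
  shows "PF S = {int s - 1}"
proof -
  have int_mem: "z \<in> int ` S \<longleftrightarrow> 0 \<le> z \<and> (even z \<or> int s \<le> z)" for z
  proof
    assume "z \<in> int ` S"
    then show "0 \<le> z \<and> (even z \<or> int s \<le> z)" using mem by auto
  next
    assume z: "0 \<le> z \<and> (even z \<or> int s \<le> z)"
    then have "nat z \<in> S" using mem by (auto simp: even_nat_iff le_nat_iff)
    then show "z \<in> int ` S" using z by (metis image_eqI int_nat_eq)
  qed
  show ?thesis
  proof (intro equalityI subsetI)
    fix z assume "z \<in> PF S"
    then have gap: "z \<notin> int ` S" and shift: "\<And>x. x \<in> S \<Longrightarrow> x \<noteq> 0 \<Longrightarrow> z + int x \<in> int ` S"
      by (auto simp: PF_def)
    \<comment> \<open>The shift by \<open>2\<close> excludes odd \<open>z < s - 1\<close>, the shift by \<open>s + 1\<close> even (hence negative) \<open>z\<close>.\<close>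
    have "z + 2 \<in> int ` S" "z + (int s + 1) \<in> int ` S"
      using shift[of 2] shift[of "s + 1"] mem s by (simp_all add: add.commute)
    with gap s have "z = int s - 1"
      unfolding int_mem by presburger
    then show "z \<in> {int s - 1}" by simp
  next
    fix z assume "z \<in> {int s - 1}"
    then show "z \<in> PF S"
      using s unfolding PF_def int_mem by auto
  qed
qed

lemma row_factorization_matrix_two_odd:
  assumes gens: "minimal_generators S = {2, s + 1}" and PF: "int s - 1 \<in> PF S" and s: "1 < s"
  shows "row_factorization_matrix S (int s - 1) M \<longleftrightarrow>
         M = mat_of_rows_list 2 [[-1, 1], [int s, -1]]"
proof -
  have ns: "sorted_list_of_set (minimal_generators S) = [2, s + 1]"
    unfolding gens using s by (simp add: insort_key.simps)
  have lt2: "(\<forall>i<2. P i) \<longleftrightarrow> P 0 \<and> P 1" for P :: "nat \<Rightarrow> bool"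
    by (auto simp: less_2_cases_iff)
  have row: "int s - 1 = - 2 + a * (int s + 1) \<longleftrightarrow> a = 1" for a
  proof -
    have "int s - 1 = - 2 + a * (int s + 1) \<longleftrightarrow> (a - 1) * (int s + 1) = 0"
      by (auto simp: algebra_simps)
    then show ?thesis using s by auto
  qed
  have sum2: "(\<Sum>j<2. f j) = f 0 + f 1" for f :: "nat \<Rightarrow> int"
    by (simp add: numeral_2_eq_2)
  have len: "length [2, s + 1] = 2" by simp
  have "row_factorization_matrix S (int s - 1) M \<longleftrightarrow>
        M \<in> carrier_mat 2 2 \<and> M $$ (0, 0) = -1 \<and> M $$ (1, 1) = -1 \<and>
        M $$ (0, 1) = 1 \<and> M $$ (1, 0) = int s"
    using PF row[of "M $$ (0, 1)"]
    unfolding row_factorization_matrix_def ns Let_def len lt2 sum2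
    by (auto simp: add.commute)
  also have "\<dots> \<longleftrightarrow> M = mat_of_rows_list 2 [[-1, 1], [int s, -1]]"
    by (auto simp: mat_of_rows_list_def mat_eq_iff less_Suc_eq numeral_2_eq_2)
  finally show ?thesis .
qed

theorem proposition3p1:
  fixes S :: "nat set" and s :: nat
  assumes "numerical_semigroup S"
    and "Arf S"
    and "multiplicity_of S = 2"
    and "conductor S = int s"
    and "0 < s"
    and "even s"
  shows "S = generated {2, s + 1} \<and>
         PF S = {int s - 1} \<and>
         (\<forall>M. row_factorization_matrix S (int s - 1) M \<longleftrightarrow>
              M = mat_of_rows_list 2 [[-1, 1], [int s, -1]])"
proof -
  have mem: "x \<in> S \<longleftrightarrow> even x \<or> s \<le> x" for x
    using assms by (intro multiplicity_two_mem_iff)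
  have gen: "S = generated {2, s + 1}"
    using mem generated_two_odd[OF assms(6)] by auto
  have PF: "PF S = {int s - 1}"
    using mem assms(5,6) by (rule PF_two_odd)
  have "1 < s" using assms(5,6) by presburger
  moreover have "minimal_generators S = {2, s + 1}"
    using assms(1) gen assms(5,6) by (rule minimal_generators_two_odd)
  ultimately show ?thesis
    using gen PF row_factorization_matrix_two_odd by auto
qed

end
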